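(* Let $L>0$ and let $P_L(t)=\sum_{n\ge2,\ \log n<2L}\frac{2\Lambda(n)}{\sqrt n}\cos(t\log n)$ be the prime comb. Then $$\sup_{t\in\mathbb R}P_L(t)=A_L,\qquad A_L=\sum_{n\ge2,\ \log n<2L}\frac{2\Lambda(n)}{\sqrt n}.$$ Consequently the constant $C=A_L$ is optimal among all pointwise bounds $P_L(t)\le C$ valid for every $t\in\mathbb R$.
   Context: $\Lambda$ is the von Mangoldt function. *)

theory Defs
  imports "HOL-Analysis.Analysis" "HOL-Number_Theory.Prime_Powers"
begin

definition comb_support :: "real \<Rightarrow> nat set" where
  "comb_support L = {n. n \<ge> 2 \<and> ln (real n) < 2 * L}"

(* The sums below range over a finite set, so they are not the default value 0
   that sum takes on infinite sets. *)
lemma finite_comb_support: "finite (comb_support L)"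
proof (rule finite_subset)
  show "comb_support L \<subseteq> {..nat \<lceil>exp (2 * L)\<rceil>}"
  proof
    fix n assume "n \<in> comb_support L"
    hence n: "n \<ge> 2" "ln (real n) < 2 * L"
      by (auto simp: comb_support_def)
    from n have "real n < exp (2 * L)"
      by (metis exp_less_cancel_iff exp_ln gr0I not_numeral_le_zero of_nat_0_less_iff)
    thus "n \<in> {..nat \<lceil>exp (2 * L)\<rceil>}"
      by (simp add: le_nat_iff) linarith
  qed
qed simp

definition prime_comb :: "real \<Rightarrow> real \<Rightarrow> real" where
  "prime_comb L t =
     (\<Sum>n\<in>comb_support L. 2 * mangoldt n / sqrt (real n) * cos (t * ln (real n)))"

definition comb_mass :: "real \<Rightarrow> real" where
  "comb_mass L = (\<Sum>n\<in>comb_support L. 2 * mangoldt n / sqrt (real n))"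

end

theory Submission
  imports Defs
begin

text \<open>
  Every coefficient of the comb is nonnegative, so \<open>cos \<le> 1\<close> bounds the comb by its mass.
  At the time \<open>0\<close> all cosines equal \<open>1\<close> simultaneously, whatever the frequencies are, so the
  bound is attained: the supremum is a maximum, and every pointwise bound is at least the value
  at \<open>0\<close>.
\<close>

lemma prime_comb_le_comb_mass: "prime_comb L t \<le> comb_mass L"
  unfolding prime_comb_def comb_mass_def
proof (rule sum_mono)
  fix n
  have "2 * mangoldt n / sqrt (real n) \<ge> 0"
    by (simp add: mangoldt_nonneg)
  then show "2 * mangoldt n / sqrt (real n) * cos (t * ln (real n)) \<le> 2 * mangoldt n / sqrt (real n)"
    using mult_left_mono[OF cos_le_one] by fastforce
qed

lemma prime_comb_0: "prime_comb L 0 = comb_mass L"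
  by (simp add: prime_comb_def comb_mass_def)

theorem lemma3p2:
  fixes L :: real
  assumes "L > 0"
  shows "bdd_above (range (prime_comb L)) \<and>
         (SUP t. prime_comb L t) = comb_mass L \<and>
         (\<forall>t. prime_comb L t \<le> comb_mass L) \<and>
         (\<forall>C. (\<forall>t. prime_comb L t \<le> C) \<longrightarrow> comb_mass L \<le> C)"
proof (intro conjI allI impI)
  show "bdd_above (range (prime_comb L))"
    by (rule bdd_aboveI2) (rule prime_comb_le_comb_mass)
  show "(SUP t. prime_comb L t) = comb_mass L"
  proof (rule cSup_eq_maximum)
    show "comb_mass L \<in> range (prime_comb L)"
      by (metis prime_comb_0 rangeI)
  qed (auto intro: prime_comb_le_comb_mass)
  show "prime_comb L t \<le> comb_mass L" for t
    by (rule prime_comb_le_comb_mass)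
  show "comb_mass L \<le> C" if "\<forall>t. prime_comb L t \<le> C" for C
    using that by (metis prime_comb_0)
qed

end
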